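(* Let $n\ge 1$, let $\mathbb{V}$ be a finite-dimensional real vector space with an inner product $\langle -,-\rangle$ of euclidean or lorentzian signature, let $F\in\Lambda^{n+1}\mathbb{V}^*$, and define the linear map $[\cdots]:\Lambda^n\mathbb{V}\to\mathbb{V}$ by $$F(X_1,X_2,\dots,X_{n+1})=\langle[X_1,\dots,X_n],X_{n+1}\rangle\quad\text{for all }X_1,\dots,X_{n+1}\in\mathbb{V}.$$ Then $[\iota_\Xi F,F]=0$ for all $\Xi\in\Lambda^{n-1}\mathbb{V}$ if and only if $$[X_1,\dots,X_{n-1},[Y_1,\dots,Y_n]]=\sum_{i=1}^n[Y_1,\dots,[X_1,\dots,X_{n-1},Y_i],\dots,Y_n]$$ for all $X_1,\dots,X_{n-1},Y_1,\dots,Y_n\in\mathbb{V}$; that is, if and only if $[\cdots]$ makes $\mathbb{V}$ into a (metric) $n$-Lie algebra.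
   Context: An inner product is a nondegenerate symmetric bilinear form; euclidean means positive-definite, and lorentzian means of signature $(1,\dim\mathbb{V}-1)$. For $\Xi\in\Lambda^{n-1}\mathbb{V}$, $\iota_\Xi F$ is the $2$-form obtained by contracting $F$ with $\Xi$; for $\Xi=X_1\wedge\cdots\wedge X_{n-1}$ it is $F(X_1,\dots,X_{n-1},-,-)$. In $[\iota_\Xi F,F]$, the bracket denotes the action of a $2$-form $\omega\in\Lambda^2\mathbb{V}^*\cong\mathfrak{so}(\mathbb{V})$ on forms $\Omega\in\Lambda\mathbb{V}^*$, defined for $\omega=\alpha\wedge\beta$ with $\alpha,\beta\in\mathbb{V}^*$ by $$[\alpha\wedge\beta,\Omega]=\alpha\wedge\iota_{\beta^\sharp}\Omega-\beta\wedge\iota_{\alpha^\sharp}\Omega$$ and extended linearly in $\omega$, where $\alpha^\sharp\in\mathbb{V}$ is the vector dual to $\alpha$ under the inner product. An $n$-Lie algebra is a vector space with an alternating $n$-linear bracket $[\cdots]$ satisfying the displayed identity (each map $Y\mapsto[X_1,\dots,X_{n-1},Y]$ is a derivation of the bracket). It is metric if it has an inner product with $\langle[X_1,\dots,X_{n-1},X_n],X_{n+1}\rangle=-\langle[X_1,\dots,X_{n-1},X_{n+1}],X_n\rangle$ for all vectors, which here holds automatically because $F$ is alternating. *)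

theory Defs
  imports "HOL-Analysis.Analysis"
begin

section \<open>Inner products\<close>

definition inner_product :: "('v::real_vector \<Rightarrow> 'v \<Rightarrow> real) \<Rightarrow> bool" where
  "inner_product g \<longleftrightarrow> bilinear g \<and> (\<forall>x y. g x y = g y x) \<and>
     (\<forall>x. (\<forall>y. g x y = 0) \<longrightarrow> x = 0)"

definition euclidean_form :: "('v::real_vector \<Rightarrow> 'v \<Rightarrow> real) \<Rightarrow> bool" where
  "euclidean_form g \<longleftrightarrow> (\<forall>x. x \<noteq> 0 \<longrightarrow> g x x > 0)"

text \<open>Signature (p, q): some orthogonal basis has p vectors of positive and q vectors of
  negative square.\<close>

definition has_signature :: "('v::real_vector \<Rightarrow> 'v \<Rightarrow> real) \<Rightarrow> nat \<Rightarrow> nat \<Rightarrow> bool" where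
  "has_signature g p q \<longleftrightarrow> (\<exists>P N. finite P \<and> finite N \<and> card P = p \<and> card N = q \<and>
     independent (P \<union> N) \<and> span (P \<union> N) = UNIV \<and>
     (\<forall>u\<in>P \<union> N. \<forall>v\<in>P \<union> N. u \<noteq> v \<longrightarrow> g u v = 0) \<and>
     (\<forall>u\<in>P. g u u > 0) \<and> (\<forall>u\<in>N. g u u < 0))"

text \<open>Signature (1, dim - 1) up to the overall sign convention: both ``mostly minus'' and
  ``mostly plus'' inner products count as lorentzian.\<close>

definition lorentzian_form :: "('v::real_vector \<Rightarrow> 'v \<Rightarrow> real) \<Rightarrow> bool" where
  "lorentzian_form g \<longleftrightarrow>
     has_signature g 1 (dim (UNIV :: 'v set) - 1) \<or>
     has_signature g (dim (UNIV :: 'v set) - 1) 1"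

definition sharp :: "('v::real_vector \<Rightarrow> 'v \<Rightarrow> real) \<Rightarrow> ('v \<Rightarrow> real) \<Rightarrow> 'v" where
  "sharp g \<alpha> = (THE v. \<forall>w. g v w = \<alpha> w)"

section \<open>Exterior forms and multivectors\<close>

definition alternating_multilinear :: "nat \<Rightarrow> ('v::real_vector list \<Rightarrow> 'w::real_vector) \<Rightarrow> bool" where
  "alternating_multilinear k f \<longleftrightarrow>
     (\<forall>xs i. length xs = k \<and> i < k \<longrightarrow> linear (\<lambda>v. f (xs[i := v]))) \<and>
     (\<forall>xs i j. length xs = k \<and> i < j \<and> j < k \<and> xs ! i = xs ! j \<longrightarrow> f xs = 0)"

text \<open>A form takes the list of its arguments. Forms of degree k vanish by convention on lists of
  any other length, so that they are determined by their values on k arguments.\<close>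

type_synonym 'v form = "'v list \<Rightarrow> real"

definition forms :: "nat \<Rightarrow> 'v::real_vector form set" where
  "forms k = {\<phi>. alternating_multilinear k \<phi> \<and> (\<forall>xs. length xs \<noteq> k \<longrightarrow> \<phi> xs = 0)}"

definition one_form :: "('v \<Rightarrow> real) \<Rightarrow> 'v form" where
  "one_form \<alpha> xs = (if length xs = 1 then \<alpha> (hd xs) else 0)"

text \<open>Exterior product of a covector with a form, normalised such that the product of covectors
  \<open>\<alpha>\<close> and \<open>\<beta>\<close> has the value \<open>\<alpha> x * \<beta> y - \<alpha> y * \<beta> x\<close> on \<open>[x, y]\<close>.\<close>

definition covector_wedge :: "('v \<Rightarrow> real) \<Rightarrow> 'v form \<Rightarrow> 'v form" where
  "covector_wedge \<alpha> \<Omega> xs =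
     (\<Sum>i<length xs. (- 1) ^ i * \<alpha> (xs ! i) * \<Omega> (take i xs @ drop (Suc i) xs))"

definition interior :: "'v \<Rightarrow> 'v form \<Rightarrow> 'v form" where
  "interior v \<Omega> xs = \<Omega> (v # xs)"

text \<open>The exterior power of degree k of the space itself is realised inside the dual of
  \<^term>\<open>forms k\<close>: the decomposable multivector of \<open>xs\<close> is evaluation of forms at \<open>xs\<close>,
  and a general multivector is a linear combination of decomposable ones.\<close>

type_synonym 'v multivector = "'v form \<Rightarrow> real"

definition vector_wedge :: "'v::real_vector list \<Rightarrow> 'v multivector" where
  "vector_wedge xs = (\<lambda>\<phi>. if \<phi> \<in> forms (length xs) then \<phi> xs else 0)"

definition multivectors :: "nat \<Rightarrow> 'v::real_vector multivector set" where
  "multivectors k = {\<Xi>. \<exists>(m::nat) c X. (\<forall>i<m. length (X i) = k) \<and>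
     \<Xi> = (\<lambda>\<phi>. \<Sum>i<m. c i * vector_wedge (X i) \<phi>)}"

definition linear_on_multivectors :: "nat \<Rightarrow> ('v::real_vector multivector \<Rightarrow> 'v) \<Rightarrow> bool" where
  "linear_on_multivectors k T \<longleftrightarrow>
     (\<forall>\<Xi>\<in>multivectors k. \<forall>\<Xi>'\<in>multivectors k. T (\<lambda>\<phi>. \<Xi> \<phi> + \<Xi>' \<phi>) = T \<Xi> + T \<Xi>') \<and>
     (\<forall>\<Xi>\<in>multivectors k. \<forall>c. T (\<lambda>\<phi>. c * \<Xi> \<phi>) = c *\<^sub>R T \<Xi>)"

definition contract :: "'v multivector \<Rightarrow> 'v form \<Rightarrow> 'v form" where
  "contract \<Xi> F ys = \<Xi> (\<lambda>xs. F (xs @ ys))"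

lemma contract_vector_wedge:
  fixes F :: "'v::real_vector form"
  assumes F: "F \<in> forms (k + l)" and xs: "length xs = k" and ys: "length ys = l"
  shows "contract (vector_wedge xs) F ys = F (xs @ ys)"
proof -
  have lin: "linear (\<lambda>v. F (zs[i := v] @ ys))" if "length zs = k" "i < k" for zs i
  proof -
    have "linear (\<lambda>v. F ((zs @ ys)[i := v]))"
      using F that ys unfolding forms_def alternating_multilinear_def by auto
    then show ?thesis using that by (simp add: list_update_append)
  qed
  have alt: "F (zs @ ys) = 0" if "length zs = k" "i < j" "j < k" "zs ! i = zs ! j" for zs i j
  proof -
    have "(zs @ ys) ! i = (zs @ ys) ! j" "length (zs @ ys) = k + l" "j < k + l"
      using that ys by (auto simp: nth_append)
    then show ?thesis
      using F that(2) unfolding forms_def alternating_multilinear_def by blast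
  qed
  have "(\<lambda>zs. F (zs @ ys)) \<in> forms k"
    unfolding forms_def alternating_multilinear_def
    using lin alt F ys by (auto simp: forms_def)
  then show ?thesis using xs by (simp add: contract_def vector_wedge_def)
qed

section \<open>The action of 2-forms on forms\<close>

definition decomposable_action ::
  "('v::real_vector \<Rightarrow> 'v \<Rightarrow> real) \<Rightarrow> ('v \<Rightarrow> real) \<Rightarrow> ('v \<Rightarrow> real) \<Rightarrow> 'v form \<Rightarrow> 'v form" where
  "decomposable_action g \<alpha> \<beta> \<Omega> xs =
     covector_wedge \<alpha> (interior (sharp g \<beta>) \<Omega>) xs - covector_wedge \<beta> (interior (sharp g \<alpha>) \<Omega>) xs"

definition decomposition :: "(('v::real_vector \<Rightarrow> real) \<times> ('v \<Rightarrow> real)) list \<Rightarrow> 'v form \<Rightarrow> bool" where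
  "decomposition ps \<omega> \<longleftrightarrow> (\<forall>(\<alpha>, \<beta>)\<in>set ps. linear \<alpha> \<and> linear \<beta>) \<and>
     (\<forall>xs. \<omega> xs = (\<Sum>(\<alpha>, \<beta>)\<leftarrow>ps. covector_wedge \<alpha> (one_form \<beta>) xs))"

text \<open>The linear extension in \<open>\<omega>\<close> of \<^term>\<open>decomposable_action g\<close>. The result does not depend on
  the decomposition chosen, and every 2-form has one; see the lemmas below.\<close>

definition form_action :: "('v::real_vector \<Rightarrow> 'v \<Rightarrow> real) \<Rightarrow> 'v form \<Rightarrow> 'v form \<Rightarrow> 'v form" where
  "form_action g \<omega> \<Omega> xs =
     (\<Sum>(\<alpha>, \<beta>)\<leftarrow>(SOME ps. decomposition ps \<omega>). decomposable_action g \<alpha> \<beta> \<Omega> xs)"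

lemma sharp_eqI:
  fixes g :: "'v::real_vector \<Rightarrow> 'v \<Rightarrow> real"
  assumes g: "inner_product g" and u: "\<And>w. g u w = \<alpha> w"
  shows "sharp g \<alpha> = u"
  unfolding sharp_def
proof (rule the_equality)
  show "\<forall>w. g u w = \<alpha> w" using u by simp
next
  fix v assume v: "\<forall>w. g v w = \<alpha> w"
  have "linear (\<lambda>x. g x y)" for y
    using g by (auto simp: inner_product_def bilinear_def)
  then have "g (v - u) y = 0" for y
    using u v linear_diff[of "\<lambda>x. g x y" v u] by simp
  then have "v - u = 0" using g unfolding inner_product_def by blast
  then show "v = u" by simp
qed

lemma sharp_works:
  fixes g :: "'v::real_vector \<Rightarrow> 'v \<Rightarrow> real"
  assumes fin: "\<exists>B::'v set. finite B \<and> span B = UNIV"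
    and g: "inner_product g" and \<alpha>: "linear \<alpha>"
  shows "g (sharp g \<alpha>) w = \<alpha> w"
proof -
  have bil: "bilinear g" and nondeg: "\<And>x. (\<And>y. g x y = 0) \<Longrightarrow> x = 0"
    using g by (auto simp: inner_product_def)
  have lin1: "linear (\<lambda>x. g x y)" and lin2: "linear (g x)" for x y
    using bil by (auto simp: bilinear_def)
  obtain B0 :: "'v set" where B0: "finite B0" "span B0 = UNIV" using fin by blast
  obtain B where B: "B \<subseteq> B0" "independent B" "span B = UNIV"
    using maximal_independent_subset[of B0] B0
    by (metis span_mono span_span subset_antisym top_greatest)
  have finB: "finite B" using B(1) B0(1) finite_subset by blast
  interpret fd: finite_dimensional_vector_space "scaleR :: real \<Rightarrow> 'v \<Rightarrow> 'v" B
    using B finB by unfold_locales (auto simp: dependent_raw_def span_raw_def)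
  define T where "T v = (\<Sum>b\<in>B. g v b *\<^sub>R b)" for v
  have coeff: "c b = d b" if "(\<Sum>b\<in>B. c b *\<^sub>R b) = (\<Sum>b\<in>B. d b *\<^sub>R b)" "b \<in> B" for c d b
  proof -
    have "(\<Sum>b\<in>B. (c b - d b) *\<^sub>R b) = 0"
      using that(1) by (simp add: scaleR_left_diff_distrib sum_subtractf)
    then have "c b - d b = 0"
      using independentD[OF B(2) finB order_refl, of "\<lambda>b. c b - d b"] that(2) by blast
    then show ?thesis by simp
  qed
  have ext: "f = h" if "linear f" "linear h" "\<And>b. b \<in> B \<Longrightarrow> f b = h b" for f h :: "'v \<Rightarrow> real"
    using linear_eq_on_span[OF that(1,2), of B] that(3) B(3) by auto
  have linT: "linear T"
    unfolding T_def
    by (intro linear_compose_sum ballI linear_compose_scale_right)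
       (auto simp: linear_iff linear_add[OF lin1] linear_scale[OF lin1] scaleR_left_distrib)
  have "inj T"
    unfolding linear_injective_0[OF linT]
  proof (intro allI impI)
    fix v assume "T v = 0"
    then have "g v b = 0" if "b \<in> B" for b
      using coeff[of "g v" "\<lambda>_. 0" b] that by (simp add: T_def)
    then have "g v = (\<lambda>_. 0)"
      using ext[OF lin2, of "\<lambda>_. 0" v] by (simp add: linear_iff)
    then show "v = 0" by (intro nondeg) (simp add: fun_eq_iff)
  qed
  then have "surj T"
    using fd.linear_inj_imp_surj linT by (simp add: linear_def)
  then obtain v where v: "T v = (\<Sum>b\<in>B. \<alpha> b *\<^sub>R b)" by (metis surjD)
  have gv: "g v = \<alpha>"
    using coeff[of "g v" \<alpha>] v by (intro ext lin2 \<alpha>) (simp add: T_def)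
  then have "sharp g \<alpha> = v" by (intro sharp_eqI[OF g]) simp
  then show ?thesis using gv by simp
qed

lemma covector_wedge_one_form:
  "covector_wedge \<alpha> (one_form \<beta>) xs =
     (if length xs = 2 then \<alpha> (xs ! 0) * \<beta> (xs ! 1) - \<alpha> (xs ! 1) * \<beta> (xs ! 0) else 0)"
proof (cases "length xs = 2")
  case True
  then obtain x y where "xs = [x, y]"
    by (metis One_nat_def Suc_1 length_0_conv length_Suc_conv)
  then show ?thesis
    by (simp add: covector_wedge_def one_form_def lessThan_Suc numeral_2_eq_2)
next
  case False
  then show ?thesis
    by (auto simp: covector_wedge_def one_form_def intro!: sum.neutral)
qed

lemma two_form_decomposition:
  fixes \<omega> :: "'v::real_vector form"
  assumes fin: "\<exists>B::'v set. finite B \<and> span B = UNIV" and \<omega>: "\<omega> \<in> forms 2"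
  shows "\<exists>ps. decomposition ps \<omega>"
proof -
  obtain B0 :: "'v set" where B0: "finite B0" "span B0 = UNIV" using fin by blast
  obtain B where B: "B \<subseteq> B0" "independent B" "span B = UNIV"
    using maximal_independent_subset[of B0] B0
    by (metis span_mono span_span subset_antisym top_greatest)
  have finB: "finite B" using B(1) B0(1) finite_subset by blast
  define r where "r b x = representation B x b" for b x
  have linr: "linear (r b)" for b
    unfolding r_def linear_iff using B by (auto simp: representation_add representation_scale)
  have expand: "x = (\<Sum>b\<in>B. r b x *\<^sub>R b)" for x
    unfolding r_def using sum_representation_eq[OF B(2), of x B] B(3) finB by simp
  have lin1: "linear (\<lambda>x. \<omega> [x, y])" and lin2: "linear (\<lambda>y. \<omega> [x, y])" for x y
  proof -
    have *: "linear (\<lambda>v. \<omega> ([x, y][i := v]))" if "i < 2" for i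
    proof -
      have "length [x, y] = 2" by simp
      then show ?thesis using \<omega> that unfolding forms_def alternating_multilinear_def by blast
    qed
    show "linear (\<lambda>x. \<omega> [x, y])" using *[of 0] by simp
    show "linear (\<lambda>y. \<omega> [x, y])" using *[of 1] by simp
  qed
  have alt: "\<omega> [x, x] = 0" for x
  proof -
    have "length [x, x] = 2 \<and> (0::nat) < 1 \<and> 1 < (2::nat) \<and> [x, x] ! 0 = [x, x] ! 1" by simp
    then show ?thesis using \<omega> unfolding forms_def alternating_multilinear_def by blast
  qed
  have anti: "\<omega> [y, x] = - \<omega> [x, y]" for x y
    using alt[of "x + y"] alt[of x] alt[of y]
    by (simp add: linear_add[OF lin1] linear_add[OF lin2])
  have half: "(\<Sum>b\<in>B. r b x * \<omega> [b, y]) = \<omega> [x, y]" for x y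
  proof -
    have "\<omega> [x, y] = \<omega> [(\<Sum>b\<in>B. r b x *\<^sub>R b), y]" using expand[of x] by simp
    also have "\<dots> = (\<Sum>b\<in>B. r b x * \<omega> [b, y])"
      by (simp add: linear_sum[OF lin1] linear_scale[OF lin1])
    finally show ?thesis by simp
  qed
  obtain bs where bs: "set bs = B" "distinct bs" using finite_distinct_list[OF finB] by blast
  define ps where "ps = map (\<lambda>b. (\<lambda>x. r b x / 2, \<lambda>y. \<omega> [b, y])) bs"
  have "\<omega> xs = (\<Sum>(\<alpha>, \<beta>)\<leftarrow>ps. covector_wedge \<alpha> (one_form \<beta>) xs)" for xs
  proof -
    have "(\<Sum>(\<alpha>, \<beta>)\<leftarrow>ps. covector_wedge \<alpha> (one_form \<beta>) xs) =
        (\<Sum>b\<in>B. covector_wedge (\<lambda>x. r b x / 2) (one_form (\<lambda>y. \<omega> [b, y])) xs)"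
      using bs by (simp add: ps_def comp_def sum_list_distinct_conv_sum_set)
    also have "\<dots> = \<omega> xs"
    proof (cases "length xs = 2")
      case True
      then obtain x y where xs: "xs = [x, y]"
        by (metis One_nat_def Suc_1 length_0_conv length_Suc_conv)
      have "(\<Sum>b\<in>B. covector_wedge (\<lambda>x. r b x / 2) (one_form (\<lambda>y. \<omega> [b, y])) xs) =
          (\<Sum>b\<in>B. r b x * \<omega> [b, y]) / 2 - (\<Sum>b\<in>B. r b y * \<omega> [b, x]) / 2"
        by (simp add: xs covector_wedge_one_form sum_subtractf sum_divide_distrib)
      then show ?thesis using anti[of x y] by (simp add: half xs)
    next
      case False
      then show ?thesis using \<omega> by (simp add: covector_wedge_one_form forms_def)
    qed
    finally show ?thesis by simp
  qed
  moreover have "linear (\<lambda>x. r b x / 2)" for b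
    using linear_compose_scale_right[OF linr[of b], of "1/2"] by simp
  then have "\<forall>(\<alpha>, \<beta>)\<in>set ps. linear \<alpha> \<and> linear \<beta>"
    using lin2 by (auto simp: ps_def)
  ultimately have "decomposition ps \<omega>"
    unfolding decomposition_def by blast
  then show ?thesis by blast
qed

lemma form_action_eq:
  fixes g :: "'v::real_vector \<Rightarrow> 'v \<Rightarrow> real"
  assumes fin: "\<exists>B::'v set. finite B \<and> span B = UNIV" and g: "inner_product g"
    and \<Omega>: "\<Omega> \<in> forms k" and ps: "decomposition ps \<omega>"
  shows "form_action g \<omega> \<Omega> xs = (\<Sum>(\<alpha>, \<beta>)\<leftarrow>ps. decomposable_action g \<alpha> \<beta> \<Omega> xs)"
proof -
  have lin: "linear (\<lambda>v. \<Omega> (v # zs))" for zs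
  proof (cases "Suc (length zs) = k")
    case True
    then have "length (0 # zs) = k" "0 < k" by auto
    then have "linear (\<lambda>v. \<Omega> ((0 # zs)[0 := v]))"
      using \<Omega> unfolding forms_def alternating_multilinear_def by blast
    then show ?thesis by simp
  next
    case False
    then have "(\<lambda>v. \<Omega> (v # zs)) = (\<lambda>_. 0)" using \<Omega> by (auto simp: forms_def)
    then show ?thesis by (simp add: linear_iff)
  qed
  have ling: "linear (\<lambda>v. g v w)" for w
    using g by (auto simp: inner_product_def bilinear_def)
  let ?rest = "\<lambda>i. take i xs @ drop (Suc i) xs"
  define a where "a qs x = (\<Sum>(\<alpha>, \<beta>)\<leftarrow>qs. \<alpha> x *\<^sub>R sharp g \<beta> - \<beta> x *\<^sub>R sharp g \<alpha>)"
    for qs :: "(('v \<Rightarrow> real) \<times> ('v \<Rightarrow> real)) list" and x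
  have action: "(\<Sum>(\<alpha>, \<beta>)\<leftarrow>qs. decomposable_action g \<alpha> \<beta> \<Omega> xs) =
      (\<Sum>i<length xs. (- 1) ^ i * \<Omega> (a qs (xs ! i) # ?rest i))" for qs
  proof (induction qs)
    case Nil
    then show ?case by (simp add: a_def linear_0[OF lin])
  next
    case (Cons p qs)
    obtain \<alpha> \<beta> where p: "p = (\<alpha>, \<beta>)" by fastforce
    have "decomposable_action g \<alpha> \<beta> \<Omega> xs =
        (\<Sum>i<length xs. (- 1) ^ i *
          \<Omega> ((\<alpha> (xs ! i) *\<^sub>R sharp g \<beta> - \<beta> (xs ! i) *\<^sub>R sharp g \<alpha>) # ?rest i))"
      unfolding decomposable_action_def covector_wedge_def interior_def sum_subtractf[symmetric]
      by (intro sum.cong refl) (simp add: linear_diff[OF lin] linear_scale[OF lin] algebra_simps)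
    then show ?case
      by (simp add: p a_def Cons.IH[unfolded a_def] linear_add[OF lin] distrib_left sum.distrib)
  qed
  have a: "a qs x = sharp g (\<lambda>y. \<omega> [x, y])" if "decomposition qs \<omega>" for qs x
  proof (rule sharp_eqI[OF g, symmetric])
    fix w
    have "g (a qs x) w = (\<Sum>(\<alpha>, \<beta>)\<leftarrow>qs. covector_wedge \<alpha> (one_form \<beta>) [x, w])"
      if "\<forall>(\<alpha>, \<beta>)\<in>set qs. linear \<alpha> \<and> linear \<beta>"
      using that
    proof (induction qs)
      case Nil
      then show ?case by (simp add: a_def linear_0[OF ling])
    next
      case (Cons p qs)
      obtain \<alpha> \<beta> where p: "p = (\<alpha>, \<beta>)" by fastforce
      then show ?case
        using Cons by (simp add: a_def linear_add[OF ling] linear_diff[OF ling]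
            linear_scale[OF ling] sharp_works[OF fin g] covector_wedge_one_form)
    qed
    then show "g (a qs x) w = \<omega> [x, w]" using that by (simp add: decomposition_def)
  qed
  have "decomposition (SOME ps. decomposition ps \<omega>) \<omega>" using ps by (rule someI)
  then have "a (SOME ps. decomposition ps \<omega>) = a ps" using a ps by auto
  then show ?thesis by (simp add: form_action_def action)
qed

corollary form_action_decomposable:
  fixes g :: "'v::real_vector \<Rightarrow> 'v \<Rightarrow> real"
  assumes "\<exists>B::'v set. finite B \<and> span B = UNIV" and "inner_product g" and "\<Omega> \<in> forms k"
    and "linear \<alpha>" and "linear \<beta>"
  shows "form_action g (covector_wedge \<alpha> (one_form \<beta>)) \<Omega> = decomposable_action g \<alpha> \<beta> \<Omega>"
  using form_action_eq[OF assms(1-3), of "[(\<alpha>, \<beta>)]"] assms(4,5)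
  by (auto simp: decomposition_def)

corollary form_action_add:
  fixes g :: "'v::real_vector \<Rightarrow> 'v \<Rightarrow> real"
  assumes fin: "\<exists>B::'v set. finite B \<and> span B = UNIV" and g: "inner_product g"
    and \<Omega>: "\<Omega> \<in> forms k" and \<omega>: "\<omega> \<in> forms 2" and \<omega>': "\<omega>' \<in> forms 2"
  shows "form_action g (\<lambda>xs. \<omega> xs + \<omega>' xs) \<Omega> xs = form_action g \<omega> \<Omega> xs + form_action g \<omega>' \<Omega> xs"
proof -
  obtain ps qs where "decomposition ps \<omega>" "decomposition qs \<omega>'"
    using two_form_decomposition[OF fin] \<omega> \<omega>' by blast
  moreover from this have "decomposition (ps @ qs) (\<lambda>xs. \<omega> xs + \<omega>' xs)"
    by (auto simp: decomposition_def)
  ultimately show ?thesis using form_action_eq[OF fin g \<Omega>] by simp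
qed

section \<open>n-Lie algebras\<close>

definition fundamental_identity :: "nat \<Rightarrow> ('v::real_vector list \<Rightarrow> 'v) \<Rightarrow> bool" where
  "fundamental_identity n b \<longleftrightarrow>
     (\<forall>xs ys. length xs = n - 1 \<and> length ys = n \<longrightarrow>
        b (xs @ [b ys]) = (\<Sum>i<n. b (ys[i := b (xs @ [ys ! i])])))"

definition n_Lie_algebra :: "nat \<Rightarrow> ('v::real_vector list \<Rightarrow> 'v) \<Rightarrow> bool" where
  "n_Lie_algebra n b \<longleftrightarrow> alternating_multilinear n b \<and> fundamental_identity n b"

definition metric_n_Lie_algebra ::
  "('v::real_vector \<Rightarrow> 'v \<Rightarrow> real) \<Rightarrow> nat \<Rightarrow> ('v list \<Rightarrow> 'v) \<Rightarrow> bool" where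
  "metric_n_Lie_algebra g n b \<longleftrightarrow> n_Lie_algebra n b \<and> inner_product g \<and>
     (\<forall>xs u v. length xs = n - 1 \<longrightarrow> g (b (xs @ [u])) v = - g (b (xs @ [v])) u)"

text \<open>The form F and the inner product do determine a bracket.\<close>

lemma bracket_exists:
  fixes g :: "'v::real_vector \<Rightarrow> 'v \<Rightarrow> real"
  assumes fin: "\<exists>B::'v set. finite B \<and> span B = UNIV" and g: "inner_product g"
    and F: "F \<in> forms (n + 1)"
  shows "\<exists>br. linear_on_multivectors n br \<and>
    (\<forall>xs v. length xs = n \<longrightarrow> F (xs @ [v]) = g (br (vector_wedge xs)) v)"
proof -
  define br where "br \<Xi> = sharp g (\<lambda>v. contract \<Xi> F [v])" for \<Xi>
  have linF: "linear (\<lambda>v. F (xs @ [v]))" if "length xs = n" for xs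
  proof -
    have "linear (\<lambda>v. F ((xs @ [0])[n := v]))"
      using F that unfolding forms_def alternating_multilinear_def by auto
    then show ?thesis using that by (simp add: list_update_append)
  qed
  have dec: "contract (vector_wedge xs) F [v] = F (xs @ [v])" if "length xs = n" for xs v
    using contract_vector_wedge[of F n 1 xs "[v]"] F that by simp
  have lin: "linear (\<lambda>v. contract \<Xi> F [v])" if mv: "\<Xi> \<in> multivectors n" for \<Xi>
  proof -
    obtain m c X where X: "\<forall>i<(m::nat). length (X i) = n"
      and \<Xi>: "\<Xi> = (\<lambda>\<phi>. \<Sum>i<m. c i * vector_wedge (X i) \<phi>)"
      using mv by (auto simp: multivectors_def)
    have "contract \<Xi> F [v] = (\<Sum>i<m. c i *\<^sub>R F (X i @ [v]))" for v
      using dec X unfolding \<Xi> by (simp add: contract_def)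
    then have eq: "(\<lambda>v. contract \<Xi> F [v]) = (\<lambda>v. \<Sum>i<m. c i *\<^sub>R F (X i @ [v]))" by blast
    show ?thesis
      unfolding eq using X linF by (intro linear_compose_sum ballI linear_compose_scale_right) auto
  qed
  have lin1: "linear (\<lambda>x. g x y)" for y
    using g by (auto simp: inner_product_def bilinear_def)
  have br: "g (br \<Xi>) v = contract \<Xi> F [v]" if "\<Xi> \<in> multivectors n" for \<Xi> v
    unfolding br_def using sharp_works[OF fin g lin[OF that]] .
  have "br (\<lambda>\<phi>. \<Xi> \<phi> + \<Xi>' \<phi>) = br \<Xi> + br \<Xi>'"
    if "\<Xi> \<in> multivectors n" "\<Xi>' \<in> multivectors n" for \<Xi> \<Xi>'
    unfolding br_def[of "\<lambda>\<phi>. \<Xi> \<phi> + \<Xi>' \<phi>"]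
    by (rule sharp_eqI[OF g]) (simp add: linear_add[OF lin1] br that, simp add: contract_def)
  moreover have "br (\<lambda>\<phi>. c * \<Xi> \<phi>) = c *\<^sub>R br \<Xi>" if "\<Xi> \<in> multivectors n" for c \<Xi>
    unfolding br_def[of "\<lambda>\<phi>. c * \<Xi> \<phi>"]
    by (rule sharp_eqI[OF g]) (simp add: linear_scale[OF lin1] br that, simp add: contract_def)
  ultimately have "linear_on_multivectors n br"
    by (simp add: linear_on_multivectors_def)
  moreover have "F (xs @ [v]) = g (br (vector_wedge xs)) v" if "length xs = n" for xs v
    using that sharp_works[OF fin g, of "\<lambda>v. F (xs @ [v])" v] linF by (simp add: br_def dec)
  ultimately show ?thesis by blast
qed

end

(* For \<Xi> = X_1 \<and> ... \<and> X_(n-1) put D Y = [X_1, ..., X_(n-1), Y]. Under the metric the 2-form \<iota>_\<Xi> F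
   is the endomorphism D, so [\<iota>_\<Xi> F, F] applied to (Y_1, ..., Y_n, v) is the sum over the n + 1 slots
   of F with D inserted. The first n terms give <sum_i [Y_1, ..., D Y_i, ..., Y_n], v>; as D is
   skew, the last one, F(Y_1, ..., Y_n, D v), is -<D [Y_1, ..., Y_n], v>. Nondegeneracy
   removes v, and linearity in \<Xi> reduces the general case to decomposable \<Xi>. *)

theory Submission
  imports Defs
begin

section \<open>Slotwise rules for alternating forms\<close>

lemma form_linear:
  assumes "f \<in> forms k" "length xs = k" "i < k"
  shows "linear (\<lambda>v. f (xs[i := v]))"
  using assms unfolding forms_def alternating_multilinear_def by blast

lemma form_linear_split:
  assumes "f \<in> forms k" "length p + length q + 1 = k"
  shows "linear (\<lambda>v. f (p @ v # q))"
  using form_linear[OF assms(1), of "p @ 0 # q" "length p"] assms(2) by simp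

lemma form_repeated_eq_0:
  assumes "f \<in> forms k" "length xs = k" "i < j" "j < k" "xs ! i = xs ! j"
  shows "f xs = 0"
  using assms unfolding forms_def alternating_multilinear_def by blast

lemma form_swap_adjacent:
  assumes f: "f \<in> forms k"
  shows "f (p @ x # y # q) = - f (p @ y # x # q)"
proof (cases "length p + length q + 2 = k")
  case True
  have diag: "f (p @ z # z # q) = 0" for z
    by (rule form_repeated_eq_0[OF f, of _ "length p" "Suc (length p)"])
      (use True in \<open>auto simp: nth_append\<close>)
  have l1: "linear (\<lambda>v. f (p @ v # z # q))" for z
    using form_linear_split[OF f, of p "z # q"] True by simp
  have l2: "linear (\<lambda>v. f (p @ z # v # q))" for z
    using form_linear_split[OF f, of "p @ [z]" q] True by simp
  have "0 = f (p @ (x + y) # (x + y) # q)" by (simp add: diag)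
  also have "\<dots> = f (p @ x # y # q) + f (p @ y # x # q)"
    by (simp only: linear_add[OF l1] linear_add[OF l2]) (simp add: diag)
  finally show ?thesis by simp
next
  case False
  then show ?thesis using f by (simp add: forms_def)
qed

text \<open>Each entry of \<open>p\<close> that \<open>v\<close> passes costs one adjacent
  transposition. Peeling entries off the right end of \<open>p\<close> enlarges \<open>q\<close>,
  hence the arbitrary \<open>q\<close>.\<close>

lemma form_move_to_front:
  assumes f: "f \<in> forms k"
  shows "f (p @ v # q) = (- 1) ^ length p * f (v # p @ q)"
proof (induction p arbitrary: q rule: rev_induct)
  case (snoc x p)
  have "f ((p @ [x]) @ v # q) = - f (p @ v # x # q)"
    using form_swap_adjacent[OF f, of p x v q] by simp
  then show ?case using snoc[of "x # q"] by simp
qed simp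

section \<open>The action of a 2-form as an endomorphism inserted slot by slot\<close>

text \<open>The product of \<alpha> and \<beta> acts by inserting the endomorphism sending x to
  \<open>\<alpha> x *\<^sub>R sharp g \<beta> - \<beta> x *\<^sub>R sharp g \<alpha>\<close> into
  each slot in turn. Over a decomposition of \<omega> these endomorphisms add up to the one dual to
  \<omega> under \<open>g\<close>.\<close>

lemma form_action_sharp:
  fixes g :: "'v::real_vector \<Rightarrow> 'v \<Rightarrow> real"
  assumes fin: "\<exists>B::'v set. finite B \<and> span B = UNIV" and g: "inner_product g"
    and \<Omega>: "\<Omega> \<in> forms k" and \<omega>: "\<omega> \<in> forms 2"
  shows "form_action g \<omega> \<Omega> xs =
    (if length xs = k then \<Sum>i<k. \<Omega> (xs[i := sharp g (\<lambda>y. \<omega> [xs ! i, y])]) else 0)"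
proof -
  obtain ps where ps: "decomposition ps \<omega>"
    using two_form_decomposition[OF fin \<omega>] by blast
  have act: "form_action g \<omega> \<Omega> xs = (\<Sum>(\<alpha>, \<beta>)\<leftarrow>ps. decomposable_action g \<alpha> \<beta> \<Omega> xs)"
    by (rule form_action_eq[OF fin g \<Omega> ps])
  show ?thesis
  proof (cases "length xs = k")
    case False
    then have "decomposable_action g \<alpha> \<beta> \<Omega> xs = 0" for \<alpha> \<beta>
      using \<Omega> by (auto simp: decomposable_action_def covector_wedge_def interior_def forms_def)
    then show ?thesis using act False by (simp add: case_prod_unfold)
  next
    case True
    have lin: "linear (\<lambda>v. \<Omega> (xs[i := v]))" if "i < k" for i
      using form_linear[OF \<Omega> True that] .
    have ling: "linear (\<lambda>v. g v w)" for w
      using g by (auto simp: inner_product_def bilinear_def)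
    \<comment> \<open>The sign in \<open>covector_wedge\<close> cancels the sign of moving
      \<open>v\<close> from the front back to slot \<open>i\<close>.\<close>
    have front: "(- 1) ^ i * c * \<Omega> (v # take i xs @ drop (Suc i) xs) = c * \<Omega> (xs[i := v])"
      if "i < k" for i v c
      using form_move_to_front[OF \<Omega>, of "take i xs" v "drop (Suc i) xs"] that True
      by (simp add: upd_conv_take_nth_drop min_def)
    \<comment> \<open>\<open>a qs\<close> is the endomorphism represented by the list
      \<open>qs\<close>.\<close>
    define a where "a qs x = (\<Sum>(\<alpha>, \<beta>)\<leftarrow>qs. \<alpha> x *\<^sub>R sharp g \<beta> - \<beta> x *\<^sub>R sharp g \<alpha>)"
      for qs :: "(('v \<Rightarrow> real) \<times> ('v \<Rightarrow> real)) list" and x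
    have dec: "decomposable_action g \<alpha> \<beta> \<Omega> xs =
        (\<Sum>i<k. \<Omega> (xs[i := \<alpha> (xs ! i) *\<^sub>R sharp g \<beta> - \<beta> (xs ! i) *\<^sub>R sharp g \<alpha>]))" for \<alpha> \<beta>
      unfolding decomposable_action_def covector_wedge_def interior_def sum_subtractf[symmetric] True
      by (intro sum.cong refl)
        (simp add: linear_diff[OF lin] linear_scale[OF lin] front)
    have "(\<Sum>(\<alpha>, \<beta>)\<leftarrow>qs. decomposable_action g \<alpha> \<beta> \<Omega> xs) = (\<Sum>i<k. \<Omega> (xs[i := a qs (xs ! i)]))"
      for qs
      by (induction qs)
        (auto simp: a_def linear_0[OF lin] dec linear_add[OF lin] sum.distrib)
    moreover have "a ps x = sharp g (\<lambda>y. \<omega> [x, y])" for x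
    proof (rule sharp_eqI[OF g, symmetric])
      fix w
      have "g (a qs x) w = (\<Sum>(\<alpha>, \<beta>)\<leftarrow>qs. covector_wedge \<alpha> (one_form \<beta>) [x, w])"
        if "\<forall>(\<alpha>, \<beta>)\<in>set qs. linear \<alpha> \<and> linear \<beta>" for qs
        using that
        by (induction qs)
          (auto simp: a_def linear_0[OF ling] linear_add[OF ling] linear_diff[OF ling]
            linear_scale[OF ling] sharp_works[OF fin g] covector_wedge_one_form)
      then show "g (a ps x) w = \<omega> [x, w]" using ps by (simp add: decomposition_def)
    qed
    ultimately show ?thesis using act True by simp
  qed
qed

section \<open>Contraction with general multivectors\<close>

lemma contract_sum_vector_wedge:
  fixes F :: "'v::real_vector form"
  assumes F: "F \<in> forms (k + l)" and X: "\<forall>j<m. length (X j) = k"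
  shows "contract (\<lambda>\<phi>. \<Sum>j<(m::nat). c j * vector_wedge (X j) \<phi>) F ys =
    (if length ys = l then \<Sum>j<m. c j * F (X j @ ys) else 0)"
proof (cases "length ys = l")
  case True
  then show ?thesis
    using contract_vector_wedge[OF F _ True] X by (simp add: contract_def)
next
  case False
  have "F (X j @ ys) = 0" if "j < m" for j
    using F False X that by (simp add: forms_def)
  \<comment> \<open>\<open>vector_wedge\<close> returns either the value at \<open>X j\<close>, zero
    by degree, or its default 0.\<close>
  then have "c j * vector_wedge (X j) (\<lambda>xs. F (xs @ ys)) = 0" if "j < m" for j
    using that by (simp add: vector_wedge_def)
  then show ?thesis using False by (simp add: contract_def sum.neutral)
qed

text \<open>The last \<open>l\<close> slots of \<open>F\<close> stay free, so their linearity and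
  alternation survive; slot \<open>i\<close> of the contraction is slot \<open>k + i\<close> of
  \<open>F\<close>. With \<open>l = 2\<close> this makes \<open>form_action_sharp\<close>
  applicable.\<close>

lemma contract_multivector_in_forms:
  fixes F :: "'v::real_vector form"
  assumes F: "F \<in> forms (k + l)" and \<Xi>: "\<Xi> \<in> multivectors k"
  shows "contract \<Xi> F \<in> forms l"
proof -
  obtain m c X where X: "\<forall>j<(m::nat). length (X j) = k"
    and eq: "\<Xi> = (\<lambda>\<phi>. \<Sum>j<m. c j * vector_wedge (X j) \<phi>)"
    using \<Xi> by (auto simp: multivectors_def)
  note con = contract_sum_vector_wedge[OF F X, of c, folded eq]
  have "linear (\<lambda>v. contract \<Xi> F (xs[i := v]))" if "length xs = l" "i < l" for xs i
  proof -
    have "linear (\<lambda>v. F (X j @ xs[i := v]))" if "j < m" for j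
      using form_linear[OF F, of "X j @ xs" "k + i"] X that \<open>length xs = l\<close> \<open>i < l\<close>
      by (simp add: list_update_append)
    then have "linear (\<lambda>v. \<Sum>j<m. c j *\<^sub>R F (X j @ xs[i := v]))"
      by (intro linear_compose_sum ballI linear_compose_scale_right) auto
    then show ?thesis using that by (simp add: con)
  qed
  moreover have "contract \<Xi> F xs = 0"
    if "length xs = l" "i < j" "j < l" "xs ! i = xs ! j" for xs i j
  proof -
    have "F (X h @ xs) = 0" if "h < m" for h
      by (rule form_repeated_eq_0[OF F, of _ "k + i" "k + j"])
        (use X that \<open>length xs = l\<close> \<open>i < j\<close> \<open>j < l\<close> \<open>xs ! i = xs ! j\<close> in \<open>auto simp: nth_append\<close>)
    then show ?thesis by (simp add: con)
  qed
  ultimately show ?thesis by (auto simp: forms_def alternating_multilinear_def con)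
qed

section \<open>The bracket determined by a form\<close>

text \<open>The bracket is a function \<open>b\<close> of lists, so that the arguments below need no
  multivectors inside it; \<open>F_eq\<close> fixes it on lists of length \<open>n\<close>
  only.\<close>

locale form_bracket =
  fixes n :: nat and g :: "'v::real_vector \<Rightarrow> 'v \<Rightarrow> real" and F :: "'v form"
    and b :: "'v list \<Rightarrow> 'v"
  assumes n_pos: "n \<ge> 1"
    and fin: "\<exists>B::'v set. finite B \<and> span B = UNIV"
    and ip: "inner_product g"
    and F: "F \<in> forms (n + 1)"
    and F_eq: "\<And>xs v. length xs = n \<Longrightarrow> F (xs @ [v]) = g (b xs) v"
begin

lemma g_linear: "linear (\<lambda>x. g x y)"
  using ip by (auto simp: inner_product_def bilinear_def)

lemma g_eqI:
  assumes "\<And>y. g u y = g v y"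
  shows "u = v"
proof -
  have "g (u - v) y = 0" for y by (simp add: linear_diff[OF g_linear] assms)
  then have "u - v = 0" using ip unfolding inner_product_def by blast
  then show ?thesis by simp
qed

lemma F_eq2: "length xs = n - 1 \<Longrightarrow> F (xs @ [u, v]) = g (b (xs @ [u])) v"
  using F_eq[of "xs @ [u]" v] n_pos by simp

lemma bracket_skew:
  assumes "length xs = n - 1"
  shows "g (b (xs @ [u])) v = - g (b (xs @ [v])) u"
  using form_swap_adjacent[OF F, of xs u v "[]"] F_eq2[OF assms] by simp

text \<open>Nondegeneracy of \<open>g\<close> transfers linearity and alternation from the first
  \<open>n\<close> slots of \<open>F\<close> to \<open>b\<close>.\<close>

lemma bracket_alternating_multilinear: "alternating_multilinear n b"
proof -
  have "linear (\<lambda>v. b (xs[i := v]))" if len: "length xs = n" "i < n" for xs i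
  proof -
    have "linear (\<lambda>v. F ((xs @ [y])[i := v]))" for y
      using form_linear[OF F, of "xs @ [y]" i] len by simp
    then have lin: "linear (\<lambda>v. g (b (xs[i := v])) y)" for y
      using len by (simp add: list_update_append1 F_eq)
    show ?thesis
      unfolding linear_iff
      by (intro conjI allI; rule g_eqI)
        (simp_all add: linear_add[OF lin] linear_add[OF g_linear] linear_scale[OF lin]
          linear_scale[OF g_linear])
  qed
  moreover have "b xs = 0" if len: "length xs = n" "i < j" "j < n" "xs ! i = xs ! j" for xs i j
  proof (rule g_eqI)
    fix y
    have "F (xs @ [y]) = 0"
      by (rule form_repeated_eq_0[OF F, of _ i j]) (use len in \<open>auto simp: nth_append\<close>)
    then show "g (b xs) y = g 0 y" using len by (simp add: F_eq linear_0[OF g_linear])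
  qed
  ultimately show ?thesis by (auto simp: alternating_multilinear_def)
qed

text \<open>The left side is the derivation \<open>b (X @ [_])\<close> acting on \<open>F\<close>;
  the right side is the failure of the fundamental identity, paired with \<open>v\<close>.\<close>

lemma derivation_defect:
  assumes X: "length X = n - 1" and ys: "length ys = n"
  shows "(\<Sum>i<n + 1. F ((ys @ [v])[i := b (X @ [(ys @ [v]) ! i])])) =
    g ((\<Sum>i<n. b (ys[i := b (X @ [ys ! i])])) - b (X @ [b ys])) v"
proof -
  have "(\<Sum>i<n. F ((ys @ [v])[i := b (X @ [(ys @ [v]) ! i])])) =
      g (\<Sum>i<n. b (ys[i := b (X @ [ys ! i])])) v"
    unfolding linear_sum[OF g_linear]
    by (intro sum.cong refl) (use ys in \<open>simp add: list_update_append1 nth_append F_eq\<close>)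
  \<comment> \<open>Index \<open>n\<close> is the slot of \<open>v\<close>; symmetry and skewness
    move the derivation from \<open>v\<close> onto \<open>b ys\<close>.\<close>
  moreover have "F ((ys @ [v])[n := b (X @ [(ys @ [v]) ! n])]) = - g (b (X @ [b ys])) v"
  proof -
    have "F ((ys @ [v])[n := b (X @ [(ys @ [v]) ! n])]) = g (b ys) (b (X @ [v]))"
      using ys by (simp add: list_update_append nth_append F_eq)
    also have "\<dots> = g (b (X @ [v])) (b ys)"
      using ip by (simp add: inner_product_def)
    finally show ?thesis using bracket_skew[OF X, of v "b ys"] by simp
  qed
  ultimately show ?thesis by (simp add: linear_diff[OF g_linear])
qed

lemma form_action_contract:
  assumes X: "\<forall>j<m. length (X j) = n - 1"
  shows "form_action g (contract (\<lambda>\<phi>. \<Sum>j<(m::nat). c j * vector_wedge (X j) \<phi>) F) F xs =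
    (if length xs = n + 1
     then \<Sum>j<m. c j * (\<Sum>i<n + 1. F (xs[i := b (X j @ [xs ! i])])) else 0)"
proof -
  let ?\<Xi> = "\<lambda>\<phi>. \<Sum>j<m. c j * vector_wedge (X j) \<phi>"
  \<comment> \<open>\<open>n \<ge> 1\<close> makes the truncated \<open>n - 1\<close> plus 2 equal
    to \<open>n + 1\<close>.\<close>
  have F': "F \<in> forms ((n - 1) + 2)" using F n_pos by simp
  have "?\<Xi> \<in> multivectors (n - 1)" using X by (auto simp: multivectors_def)
  then have \<omega>: "contract ?\<Xi> F \<in> forms 2" by (rule contract_multivector_in_forms[OF F'])
  \<comment> \<open>The endomorphism dual to the contracted form is the same linear combination of
    the derivations given by the \<open>X j\<close>.\<close>
  have sharp: "sharp g (\<lambda>y. contract ?\<Xi> F [x, y]) = (\<Sum>j<m. c j *\<^sub>R b (X j @ [x]))" for x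
    by (rule sharp_eqI[OF ip])
      (use X in \<open>simp add: contract_sum_vector_wedge[OF F' X] linear_sum[OF g_linear]
        linear_scale[OF g_linear] F_eq2\<close>)
  have "(\<Sum>i<n + 1. F (xs[i := \<Sum>j<m. c j *\<^sub>R b (X j @ [xs ! i])])) =
      (\<Sum>j<m. c j * (\<Sum>i<n + 1. F (xs[i := b (X j @ [xs ! i])])))" if "length xs = n + 1"
  proof -
    have "(\<Sum>i<n + 1. F (xs[i := \<Sum>j<m. c j *\<^sub>R b (X j @ [xs ! i])])) =
        (\<Sum>i<n + 1. \<Sum>j<m. c j * F (xs[i := b (X j @ [xs ! i])]))"
      by (intro sum.cong refl)
        (simp add: linear_sum[OF form_linear[OF F that]] linear_scale[OF form_linear[OF F that]])
    then show ?thesis by (subst (asm) sum.swap) (simp only: sum_distrib_left)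
  qed
  then show ?thesis by (simp only: form_action_sharp[OF fin ip F \<omega>] sharp split: if_split) simp
qed

lemma form_action_zero_iff_fundamental_identity:
  "(\<forall>\<Xi>\<in>multivectors (n - 1). form_action g (contract \<Xi> F) F = (\<lambda>_. 0)) \<longleftrightarrow>
    fundamental_identity n b" (is "?L \<longleftrightarrow> ?R")
proof
  assume L: ?L
  show ?R unfolding fundamental_identity_def
  proof (intro allI impI)
    fix X ys :: "'v list" assume len: "length X = n - 1 \<and> length ys = n"
    \<comment> \<open>A decomposable multivector written as a one-term sum, the shape required by
      \<open>form_action_contract\<close>.\<close>
    let ?\<Xi> = "\<lambda>\<phi>. \<Sum>j<(1::nat). 1 * vector_wedge X \<phi>"
    have "?\<Xi> \<in> multivectors (n - 1)"
      unfolding multivectors_def using len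
      by (intro CollectI exI[of _ 1] exI[of _ "\<lambda>_. 1"] exI[of _ "\<lambda>_. X"]) simp
    with L have zero: "form_action g (contract ?\<Xi> F) F = (\<lambda>_. 0)" by blast
    have "(\<Sum>i<n. b (ys[i := b (X @ [ys ! i])])) - b (X @ [b ys]) = 0"
    proof (rule g_eqI)
      fix v
      have "(\<Sum>i<n + 1. F ((ys @ [v])[i := b (X @ [(ys @ [v]) ! i])])) = 0"
        using form_action_contract[of 1 "\<lambda>_. X" "\<lambda>_. 1" "ys @ [v]", unfolded zero] len by simp
      then show "g ((\<Sum>i<n. b (ys[i := b (X @ [ys ! i])])) - b (X @ [b ys])) v = g 0 v"
        using derivation_defect[of X ys v] len by (simp add: linear_0[OF g_linear])
    qed
    then show "b (X @ [b ys]) = (\<Sum>i<n. b (ys[i := b (X @ [ys ! i])]))" by simp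
  qed
next
  assume R: ?R
  show ?L
  proof (intro ballI ext)
    fix \<Xi> :: "'v multivector" and xs :: "'v list"
    assume "\<Xi> \<in> multivectors (n - 1)"
    then obtain m c X where X: "\<forall>j<(m::nat). length (X j) = n - 1"
      and \<Xi>: "\<Xi> = (\<lambda>\<phi>. \<Sum>j<m. c j * vector_wedge (X j) \<phi>)"
      by (auto simp: multivectors_def)
    have "(\<Sum>i<n + 1. F (xs[i := b (X j @ [xs ! i])])) = 0" if j: "j < m" and len: "length xs = n + 1" for j
    proof -
      \<comment> \<open>The last argument plays the role of the test vector
        \<open>v\<close>.\<close>
      obtain ys v where xs: "xs = ys @ [v]" "length ys = n"
        using len by (metis Suc_eq_plus1 length_Suc_conv_rev)
      have "b (X j @ [b ys]) = (\<Sum>i<n. b (ys[i := b (X j @ [ys ! i])]))"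
        using R X j xs by (simp add: fundamental_identity_def)
      then show ?thesis
        unfolding xs(1) using derivation_defect[of "X j" ys v] X j xs(2)
        by (simp add: linear_0[OF g_linear])
    qed
    then show "form_action g (contract \<Xi> F) F xs = 0"
      unfolding \<Xi> form_action_contract[OF X] by simp
  qed
qed

end

theorem mainTheorem8:
  fixes n :: nat
    and g :: "'v::real_vector \<Rightarrow> 'v \<Rightarrow> real"
    and F :: "'v form"
    and br :: "'v multivector \<Rightarrow> 'v"
  assumes "n \<ge> 1"
    and "\<exists>B::'v set. finite B \<and> span B = UNIV"
    and "inner_product g"
    and "euclidean_form g \<or> lorentzian_form g"
    and "F \<in> forms (n + 1)"
    and "linear_on_multivectors n br"
    and "\<forall>xs v. length xs = n \<longrightarrow> F (xs @ [v]) = g (br (vector_wedge xs)) v"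
  shows "((\<forall>\<Xi>\<in>multivectors (n - 1). form_action g (contract \<Xi> F) F = (\<lambda>_. 0)) \<longleftrightarrow>
           fundamental_identity n (\<lambda>xs. br (vector_wedge xs))) \<and>
         ((\<forall>\<Xi>\<in>multivectors (n - 1). form_action g (contract \<Xi> F) F = (\<lambda>_. 0)) \<longleftrightarrow>
           n_Lie_algebra n (\<lambda>xs. br (vector_wedge xs))) \<and>
         ((\<forall>\<Xi>\<in>multivectors (n - 1). form_action g (contract \<Xi> F) F = (\<lambda>_. 0)) \<longleftrightarrow>
           metric_n_Lie_algebra g n (\<lambda>xs. br (vector_wedge xs)))"
proof -
  interpret form_bracket n g F "\<lambda>xs. br (vector_wedge xs)"
    using assms by unfold_locales auto
  \<comment> \<open>Alternation and the metric condition hold for every bracket coming from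
    \<open>F\<close>, so the three right-hand sides are equivalent.\<close>
  have "n_Lie_algebra n (\<lambda>xs. br (vector_wedge xs)) \<longleftrightarrow>
      fundamental_identity n (\<lambda>xs. br (vector_wedge xs))"
    using bracket_alternating_multilinear by (simp add: n_Lie_algebra_def)
  moreover have "metric_n_Lie_algebra g n (\<lambda>xs. br (vector_wedge xs)) \<longleftrightarrow>
      n_Lie_algebra n (\<lambda>xs. br (vector_wedge xs))"
    unfolding metric_n_Lie_algebra_def using ip bracket_skew by blast
  ultimately show ?thesis
    using form_action_zero_iff_fundamental_identity by simp
qed

end
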